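(* Let $n\ge 1$ be an integer, let $I\subset[0,\infty)$ be an interval, and let $f:I\to\mathbb{R}$ be an $n$-times differentiable function on $I^\circ$ such that $f^{(n)}\in L^1[a,b]$, where $a,b\in I$, $a<b$. Let $p,q$ be conjugate numbers, $\frac1p+\frac1q=1$, where $q\ge 1$. If $|f^{(n)}|^q$ is concave on $[a,b]$, then for every $\lambda\in[a,b]$, $$\left|(-1)^n\int_a^b f(x)\,dx+\sum_{m=1}^n(-1)^{n-m+2}\left[\frac{(\lambda-a)^m-(\lambda-b)^m}{m!}\right]f^{(m-1)}(\lambda)\right|$$ $$\le\frac{(np+1)^{-\frac1p}}{n!}\left[(\lambda-a)^{n+1}\left|f^{(n)}\left(\frac{a+\lambda}{2}\right)\right|+(b-\lambda)^{n+1}\left|f^{(n)}\left(\frac{b+\lambda}{2}\right)\right|\right].$$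
   Context: $I^\circ$ denotes the interior of $I$. It is understood that $f$ is $n$ times differentiable at every point of $[a,b]$ (one-sided at a point that is an endpoint of $I$), so that $f^{(n)}$ is defined on all of $[a,b]$; $f^{(0)}=f$. When $q=1$ (so $p=\infty$), the factor $(np+1)^{-1/p}$ is read as its limit $1$. *)

theory Defs
  imports "HOL-Analysis.Analysis"
begin

text \<open>
  Derivatives are taken within the interval \<open>I\<close>: they are two-sided at interior points of \<open>I\<close>
  and one-sided at an endpoint belonging to \<open>I\<close>. At a point where the derivative does not exist,
  the value is unspecified. If \<open>S\<close> is the union of the interior of \<open>I\<close> and some part of \<open>I\<close>, then
  \<open>S\<close> contains a neighbourhood, relative to \<open>I\<close>, of each of its points, so such values outside
  \<open>S\<close> never influence the derivatives at points of \<open>S\<close>.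
\<close>

primrec nth_deriv_within :: "real set \<Rightarrow> nat \<Rightarrow> (real \<Rightarrow> real) \<Rightarrow> real \<Rightarrow> real" where
  "nth_deriv_within I 0 f = f"
| "nth_deriv_within I (Suc k) f =
     (\<lambda>x. vector_derivative (nth_deriv_within I k f) (at x within I))"

definition times_differentiable_on ::
    "real set \<Rightarrow> nat \<Rightarrow> (real \<Rightarrow> real) \<Rightarrow> real set \<Rightarrow> bool" where
  "times_differentiable_on I n f S \<longleftrightarrow>
     (\<forall>k<n. \<forall>x\<in>S. nth_deriv_within I k f differentiable (at x within I))"

text \<open>
  Since \<open>1 / \<infinity> = 0\<close> in \<^typ>\<open>ennreal\<close>, the exponent conjugate to \<open>q = 1\<close> is \<open>p = \<infinity>\<close>.
\<close>

definition conjugate_exponents :: "ennreal \<Rightarrow> real \<Rightarrow> bool" where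
  "conjugate_exponents p q \<longleftrightarrow> q \<ge> 1 \<and> 1 / p + 1 / ennreal q = 1"

text \<open>
  The factor \<open>(n p + 1)\<close> to the power \<open>- 1 / p\<close>, with its limit \<open>1\<close> as value at \<open>p = \<infinity>\<close>.
\<close>

definition conjugate_factor :: "nat \<Rightarrow> ennreal \<Rightarrow> real" where
  "conjugate_factor n p =
     (if p = \<infinity> then 1 else (real n * enn2real p + 1) powr (- 1 / enn2real p))"

end

theory Submission
  imports Defs
begin

text \<open>
  Splitting the integral at \<open>c\<close>, the expression on the left is, up to the sign \<open>(-1) ^ n\<close>, the
  difference of two Taylor remainders: an antiderivative of \<open>f\<close> is expanded about \<open>c\<close> up to degree
  \<open>n\<close> and evaluated at \<open>b\<close> and at \<open>a\<close>. The remainder at \<open>b\<close> is the integral of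
  \<open>(b - t) ^ n / n! * f\<^sup>(\<^sup>n\<^sup>) t\<close> over \<open>{c..b}\<close>, and the one at \<open>a\<close> is its mirror image, so it
  suffices to bound one of them.

  Hoelder's inequality separates the kernel \<open>(b - t) ^ n\<close> from the derivative. The \<open>p\<close>-norm of the
  kernel contributes the factor \<open>(n p + 1)\<close> to the power \<open>- 1 / p\<close>. The integral of \<open>\<bar>f\<^sup>(\<^sup>n\<^sup>)\<bar>\<close> to
  the power \<open>q\<close> is at most the length of the interval times the value at
  its midpoint: this is the Hermite--Hadamard inequality for concave functions.

  The two steps are carried out together in \<open>kernel_integral_bound\<close>. Hoelder's inequality appears
  there in the form of its usual proof: Young's inequality is applied pointwise, to factors that
  are scaled so that both integrals on the right equal or are bounded by the length of the
  interval. The remainder formula itself is applied in \<open>Taylor_integral_bound\<close>.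
\<close>

section \<open>Conjugate exponents\<close>

lemma conjugate_exponents_cases:
  assumes "conjugate_exponents p q"
  obtains "p = \<infinity>" "q = 1"
    | r where "p = ennreal r" "r > 1" "q > 1" "1 / r + 1 / q = 1"
proof -
  have q: "q \<ge> 1" and pq: "1 / p + 1 / ennreal q = 1"
    using assms by (auto simp: conjugate_exponents_def)
  have q': "1 / ennreal q = ennreal (1 / q)"
    using q by (metis divide_ennreal ennreal_1 less_le_trans zero_le_one zero_less_one)
  show thesis
  proof (cases "q = 1")
    case True
    then have "1 / p = 0"
      using pq by simp
    then have "p = \<infinity>"
      by (simp add: ennreal_divide_eq_0_iff)
    then show thesis using True that by blast
  next
    case False
    then have q1: "q > 1" using q by simp
    have "p \<noteq> \<infinity>"
    proof
      assume "p = \<infinity>"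
      then have "ennreal (1 / q) = ennreal 1" using pq q' by simp
      then show False using q1 by (subst (asm) ennreal_inj) auto
    qed
    moreover have "p \<noteq> 0"
      using pq by auto
    ultimately obtain r where r: "p = ennreal r" "r > 0"
      by (cases p) (auto simp: less_le)
    have "1 / p = ennreal (1 / r)"
      using r by (metis divide_ennreal ennreal_1 zero_le_one)
    then have "ennreal (1 / r + 1 / q) = ennreal 1"
      using pq q' r q1 by simp
    then have eq: "1 / r + 1 / q = 1"
      using r q1 by (subst (asm) ennreal_inj) auto
    have "1 / r < 1" using eq q1 by (smt (verit) zero_less_divide_1_iff)
    then have "r > 1" using r by (simp add: field_simps)
    then show thesis using that r q1 eq by blast
  qed
qed

section \<open>Concave functions on a compact interval\<close>

lemma has_integral_reflect_shift:
  fixes f :: "real \<Rightarrow> real"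
  assumes "(f has_integral i) {a..b}"
  shows "((\<lambda>x. f (s - x)) has_integral i) {s - b..s - a}"
proof -
  have "(\<lambda>x. s - x) ` {a..b} = {s - b..s - a}"
    by (simp add: image_diff_atLeastAtMost)
  then show ?thesis
    using has_integral_affinity[of f i a b "-1" s] assms
    by simp
qed

lemma concave_on_Icc_midpoint:
  fixes g :: "real \<Rightarrow> real"
  assumes "concave_on {c..b} g" "t \<in> {c..b}"
  shows "g t + g (c + b - t) \<le> 2 * g ((c + b) / 2)"
proof -
  have "(1 - 1/2) * g t + 1/2 * g (c + b - t) \<le> g ((1 - 1/2) *\<^sub>R t + (1/2) *\<^sub>R (c + b - t))"
    by (rule concave_onD[OF assms(1)]) (use assms(2) in auto)
  also have "(1 - 1/2) *\<^sub>R t + (1/2) *\<^sub>R (c + b - t) = (c + b) / 2"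
    by (simp add: field_simps)
  finally show ?thesis by simp
qed

text \<open>
  A concave function is continuous in the interior of the interval, hence measurable there, and the
  midpoint inequality bounds a nonnegative one from above; the end points, where it may jump, form
  a null set.
\<close>

lemma concave_on_Icc_integrable:
  fixes g :: "real \<Rightarrow> real"
  assumes conc: "concave_on {c..b} g" and nonneg: "\<And>t. t \<in> {c..b} \<Longrightarrow> g t \<ge> 0"
  shows "g integrable_on {c..b}"
proof -
  have "concave_on {c<..<b} g"
    using conc by (auto simp: concave_on_iff)
  then have "continuous_on {c<..<b} (\<lambda>x. - g x)"
    by (intro convex_on_continuous) (auto simp: concave_on_def)
  then have "continuous_on {c<..<b} g"
    using continuous_on_minus by fastforce
  then have "g \<in> borel_measurable (lebesgue_on {c<..<b})"
    by (rule continuous_imp_measurable_on_sets_lebesgue) simp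
  moreover have "(\<lambda>t. 2 * g ((c + b) / 2)) integrable_on {c<..<b}"
    by (simp add: integrable_on_open_interval_real integrable_const_ivl)
  moreover have "\<bar>g t\<bar> \<le> 2 * g ((c + b) / 2)" if "t \<in> {c<..<b}" for t
    using concave_on_Icc_midpoint[OF conc, of t] nonneg[of t] nonneg[of "c + b - t"] that
    by auto
  ultimately have "g integrable_on {c<..<b}"
    by (rule measurable_bounded_by_integrable_imp_integrable_real) simp_all
  then show ?thesis
    by (simp add: integrable_on_open_interval_real)
qed

text \<open>
  Reflecting the interval at its midpoint does not change the integral, so the average of \<open>g\<close> is
  also the average of \<open>(g t + g (c + b - t)) / 2\<close>, which never exceeds the value at the midpoint.
\<close>

lemma Hermite_Hadamard_concave:
  fixes g :: "real \<Rightarrow> real"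
  assumes conc: "concave_on {c..b} g" and "c \<le> b" and int: "g integrable_on {c..b}"
  shows "integral {c..b} g \<le> (b - c) * g ((c + b) / 2)"
proof -
  have "(g has_integral integral {c..b} g) {c..b}"
    using int by blast
  moreover from has_integral_reflect_shift[OF this, of "c + b"]
  have "((\<lambda>t. g (c + b - t)) has_integral integral {c..b} g) {c..b}"
    by simp
  ultimately have "((\<lambda>t. g t + g (c + b - t)) has_integral
      integral {c..b} g + integral {c..b} g) {c..b}"
    by (rule has_integral_add)
  moreover have "((\<lambda>t. 2 * g ((c + b) / 2)) has_integral (b - c) * (2 * g ((c + b) / 2))) {c..b}"
    using has_integral_const_real[of "2 * g ((c + b) / 2)" c b] \<open>c \<le> b\<close> by simp
  ultimately have "integral {c..b} g + integral {c..b} g \<le> (b - c) * (2 * g ((c + b) / 2))"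
    by (rule has_integral_le) (rule concave_on_Icc_midpoint[OF conc])
  then show ?thesis by (simp add: algebra_simps)
qed

section \<open>Bounds for Taylor remainders\<close>

text \<open>
  Integrating this inequality gives Hoelder's inequality when \<open>\<alpha>\<close> and \<open>M\<close> are the \<open>r\<close>-norm of
  \<open>x\<close> and the \<open>q\<close>-norm of \<open>y\<close> for the normalised measure on the interval; an upper bound for a norm
  serves just as well.
\<close>

lemma Young_scaled:
  fixes x y \<alpha> M r q :: real
  assumes "r > 1" "q > 1" "1 / r + 1 / q = 1" "x \<ge> 0" "y \<ge> 0" "\<alpha> > 0" "M > 0"
  shows "x * y \<le> \<alpha> * M * (x powr r / (\<alpha> powr r * r) + y powr q / (M powr q * q))"
proof -
  have "x / \<alpha> * (y / M) \<le> (x / \<alpha>) powr r / r + (y / M) powr q / q"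
    using assms by (intro Youngs_inequality) auto
  then have "\<alpha> * M * (x / \<alpha> * (y / M)) \<le> \<alpha> * M * ((x / \<alpha>) powr r / r + (y / M) powr q / q)"
    using assms by (intro mult_left_mono) auto
  then show ?thesis using assms by (simp add: powr_divide)
qed

text \<open>
  For \<open>q = 1\<close> the kernel is replaced by its maximum \<open>(b - c) ^ n\<close>. For \<open>q > 1\<close> the scaled Young
  inequality is integrated; the scaling needs a nonzero value of \<open>u\<close> at the midpoint, and if that
  value vanishes, then concavity forces \<open>u\<close> to vanish throughout.
\<close>

lemma kernel_integral_bound:
  fixes u :: "real \<Rightarrow> real"
  assumes n: "n \<ge> 1" and cb: "c < b" and conj: "conjugate_exponents p q"
    and conc: "concave_on {c..b} (\<lambda>x. \<bar>u x\<bar> powr q)"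
    and int: "(\<lambda>t. (b - t) ^ n * u t) integrable_on {c..b}"
  shows "\<bar>integral {c..b} (\<lambda>t. (b - t) ^ n * u t)\<bar>
           \<le> conjugate_factor n p * ((b - c) ^ (n + 1) * \<bar>u ((c + b) / 2)\<bar>)"
proof -
  define g where "g = (\<lambda>x. \<bar>u x\<bar> powr q)"
  define h where "h = b - c"
  define M where "M = \<bar>u ((c + b) / 2)\<bar>"
  have h: "h > 0" using cb by (simp add: h_def)
  have conc: "concave_on {c..b} g" using conc by (simp add: g_def)
  have gint: "g integrable_on {c..b}"
    by (rule concave_on_Icc_integrable[OF conc]) (simp add: g_def)
  have HH: "integral {c..b} g \<le> h * M powr q"
    using Hermite_Hadamard_concave[OF conc _ gint] cb by (simp add: h_def M_def g_def)
  have dominated: "\<bar>integral {c..b} (\<lambda>t. (b - t) ^ n * u t)\<bar> \<le> integral {c..b} k"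
    if "k integrable_on {c..b}" "\<And>t. t \<in> {c..b} \<Longrightarrow> (b - t) ^ n * \<bar>u t\<bar> \<le> k t" for k
    using integral_norm_bound_integral[OF int that(1)] that(2)
    by (simp add: abs_mult)
  from conj show ?thesis
  proof (cases rule: conjugate_exponents_cases)
    case 1
    have "\<bar>integral {c..b} (\<lambda>t. (b - t) ^ n * u t)\<bar> \<le> integral {c..b} (\<lambda>t. h ^ n * g t)"
    proof (rule dominated)
      show "(\<lambda>t. h ^ n * g t) integrable_on {c..b}"
        by (rule integrable_on_mult_right[OF gint])
      show "(b - t) ^ n * \<bar>u t\<bar> \<le> h ^ n * g t" if "t \<in> {c..b}" for t
        using that 1 by (auto simp: g_def h_def intro!: mult_right_mono power_mono)
    qed
    also have "\<dots> = h ^ n * integral {c..b} g" by simp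
    also have "\<dots> \<le> h ^ n * (h * M powr q)"
      using HH h by (intro mult_left_mono) auto
    also have "\<dots> = h ^ (n + 1) * M" using 1 by (simp add: M_def)
    finally show ?thesis using 1 by (simp add: conjugate_factor_def h_def M_def)
  next
    case (2 r)
    show ?thesis
    proof (cases "M = 0")
      case True
      have "u t = 0" if "t \<in> {c..b}" for t
      proof -
        have "g t + g (c + b - t) \<le> 0"
          using concave_on_Icc_midpoint[OF conc that] True 2 by (simp add: g_def M_def)
        moreover have "g t \<ge> 0" "g (c + b - t) \<ge> 0" by (auto simp: g_def)
        ultimately have "g t = 0" by linarith
        then show ?thesis by (simp add: g_def)
      qed
      then have "integral {c..b} (\<lambda>t. (b - t) ^ n * u t) = integral {c..b} (\<lambda>t. 0)"
        by (intro integral_cong) simp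
      then show ?thesis using True by (simp add: M_def)
    next
      case False
      then have M: "M > 0" by (simp add: M_def)
      define s where "s = real n * r"
      have s: "s > 0" using n 2 by (simp add: s_def)
      \<comment> \<open>The \<open>r\<close>-norm of the kernel divided by \<open>h powr (1 / r)\<close>, so that the \<open>r\<close>-th power of the
        scaled kernel integrates to \<open>h\<close>; likewise \<open>\<bar>u\<bar> / M\<close> to the power \<open>q\<close> integrates to at most
        \<open>h\<close> by Hermite--Hadamard.\<close>
      define \<alpha> where "\<alpha> = h ^ n * (s + 1) powr (- 1 / r)"
      have \<alpha>: "\<alpha> > 0" using h s by (simp add: \<alpha>_def)
      have \<alpha>r: "\<alpha> powr r = h powr s / (s + 1)"
      proof -
        have "(h ^ n) powr r = h powr s"
          using h by (simp add: s_def powr_powr flip: powr_realpow)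
        moreover have "((s + 1) powr (- 1 / r)) powr r = 1 / (s + 1)"
          using s 2 by (simp add: powr_powr powr_neg_one)
        ultimately show ?thesis
          using h s by (simp add: \<alpha>_def powr_mult)
      qed
      have ker: "((\<lambda>t. ((b - t) ^ n) powr r) has_integral (h powr (s + 1) / (s + 1))) {c..b}"
      proof -
        have "((\<lambda>x. x powr s) has_integral (h powr (s + 1) / (s + 1))) {0..h}"
          using h s by (intro has_integral_powr_from_0) auto
        from has_integral_reflect_shift[OF this, of b]
        have "((\<lambda>t. (b - t) powr s) has_integral (h powr (s + 1) / (s + 1))) {c..b}"
          by (simp add: h_def)
        moreover have "(b - t) powr s = ((b - t) ^ n) powr r" if "t \<in> {c..b}" for t
          using that n by (cases "t = b") (auto simp: s_def powr_powr powr_realpow[symmetric] power_0_left)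
        ultimately show ?thesis by (rule has_integral_eq[rotated]) 
      qed
      define k where "k t = \<alpha> * M * (((b - t) ^ n) powr r / (\<alpha> powr r * r)
          + g t / (M powr q * q))" for t
      have kint: "(k has_integral \<alpha> * M * ((h powr (s + 1) / (s + 1)) / (\<alpha> powr r * r)
          + integral {c..b} g / (M powr q * q))) {c..b}"
        unfolding k_def
        by (intro has_integral_mult_right has_integral_add has_integral_divide ker)
          (use gint in blast)
      have "\<bar>integral {c..b} (\<lambda>t. (b - t) ^ n * u t)\<bar> \<le> integral {c..b} k"
      proof (rule dominated)
        show "k integrable_on {c..b}" using kint by blast
        show "(b - t) ^ n * \<bar>u t\<bar> \<le> k t" if "t \<in> {c..b}" for t
          unfolding k_def g_def using that 2 \<alpha> M by (intro Young_scaled) auto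
      qed
      also have "\<dots> = \<alpha> * M * ((h powr (s + 1) / (s + 1)) / (\<alpha> powr r * r)
          + integral {c..b} g / (M powr q * q))"
        using kint by blast
      also have "(h powr (s + 1) / (s + 1)) / (\<alpha> powr r * r) = h / r"
        using h s 2 by (simp add: \<alpha>r powr_add)
      also have "\<alpha> * M * (h / r + integral {c..b} g / (M powr q * q))
          \<le> \<alpha> * M * (h / r + h * M powr q / (M powr q * q))"
        using HH \<alpha> M 2 by (intro mult_left_mono add_left_mono divide_right_mono) auto
      also have "\<dots> = \<alpha> * M * (h * (1 / r + 1 / q))"
        using M by (simp add: distrib_left)
      also have "\<dots> = (s + 1) powr (- 1 / r) * (h ^ (n + 1) * M)"
        using 2 by (simp add: \<alpha>_def)
      finally show ?thesis
        using 2 by (simp add: conjugate_factor_def h_def M_def s_def)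
    qed
  qed
qed

text \<open>
  The remainder is that of the antiderivative \<open>F\<close> of \<open>D 0\<close>, not of \<open>D 0\<close> itself: this yields the
  kernel \<open>(b - t) ^ n / n!\<close> in one step, without an interchange of integrals, and the integral form
  of the remainder is available because the gauge integral integrates every derivative.
\<close>

lemma Taylor_integral_bound:
  fixes D :: "nat \<Rightarrow> real \<Rightarrow> real"
  assumes n: "n \<ge> 1" and cb: "c \<le> b" and conj: "conjugate_exponents p q"
    and D: "\<And>k t. k < n \<Longrightarrow> t \<in> {c..b} \<Longrightarrow>
        (D k has_real_derivative D (Suc k) t) (at t within {c..b})"
    and conc: "concave_on {c..b} (\<lambda>x. \<bar>D n x\<bar> powr q)"
  shows "\<bar>integral {c..b} (D 0) - (\<Sum>m=1..n. (b - c) ^ m / fact m * D (m - 1) c)\<bar>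
           \<le> conjugate_factor n p / fact n * ((b - c) ^ (n + 1) * \<bar>D n ((c + b) / 2)\<bar>)"
proof (cases "c = b")
  case True
  then show ?thesis by (simp add: power_0_left sum.neutral)
next
  case False
  then have cb': "c < b" using cb by simp
  define F where "F x = integral {c..x} (D 0)" for x
  define Df where "Df k = (case k of 0 \<Rightarrow> F | Suc j \<Rightarrow> D j)" for k
  have "continuous_on {c..b} (D 0)"
    using D n by (intro DERIV_continuous_on) auto
  then have F: "(F has_real_derivative D 0 t) (at t within {c..b})" if "t \<in> {c..b}" for t
    unfolding F_def using that by (rule integral_has_real_derivative)
  have Df: "(Df m has_vector_derivative Df (Suc m) t) (at t within {c..b})"
    if "m < Suc n" "c \<le> t" "t \<le> b" for m t
    using that F D by (cases m) (auto simp: Df_def has_real_derivative_iff_has_vector_derivative)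
  have "((\<lambda>x. ((b - x) ^ n / fact n) *\<^sub>R D n x) has_integral
        F b - (\<Sum>i<Suc n. ((b - c) ^ i / fact i) *\<^sub>R Df i c)) {c..b}"
    using Taylor_has_integral[of "Suc n" Df F c b] Df cb by (simp add: Df_def)
  moreover have "(\<Sum>i<Suc n. ((b - c) ^ i / fact i) *\<^sub>R Df i c)
      = (\<Sum>m=1..n. (b - c) ^ m / fact m * D (m - 1) c)"
  proof -
    have "(\<Sum>i<Suc n. ((b - c) ^ i / fact i) *\<^sub>R Df i c)
        = (\<Sum>i<n. (b - c) ^ Suc i / fact (Suc i) * D i c)"
      by (subst sum.lessThan_Suc_shift) (simp add: Df_def F_def del: fact_Suc power_Suc)
    also have "\<dots> = (\<Sum>m=1..n. (b - c) ^ m / fact m * D (m - 1) c)"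
      by (simp add: sum.atLeast_Suc_atMost_Suc_shift sum.atLeast1_atMost_eq del: fact_Suc power_Suc)
    finally show ?thesis .
  qed
  ultimately have T: "((\<lambda>x. (b - x) ^ n / fact n * D n x) has_integral
      integral {c..b} (D 0) - (\<Sum>m=1..n. (b - c) ^ m / fact m * D (m - 1) c)) {c..b}"
    (is "(_ has_integral ?R) _")
    by (simp add: F_def)
  have T': "((\<lambda>x. (b - x) ^ n * D n x) has_integral fact n * ?R) {c..b}"
    using has_integral_mult_right[OF T, of "fact n"] by (simp add: mult.assoc)
  have "\<bar>integral {c..b} (\<lambda>t. (b - t) ^ n * D n t)\<bar>
      \<le> conjugate_factor n p * ((b - c) ^ (n + 1) * \<bar>D n ((c + b) / 2)\<bar>)"
    by (rule kernel_integral_bound[OF n cb' conj conc has_integral_integrable[OF T']])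
  then have "fact n * \<bar>?R\<bar> \<le> conjugate_factor n p * ((b - c) ^ (n + 1) * \<bar>D n ((c + b) / 2)\<bar>)"
    using T' by (simp add: integral_unique abs_mult)
  then show ?thesis by (simp add: field_simps)
qed

lemma concave_on_Icc_reflect:
  fixes g :: "real \<Rightarrow> real"
  assumes "concave_on {a..c} g"
  shows "concave_on {- c..- a} (\<lambda>x. g (- x))"
  unfolding concave_on_iff
proof (intro conjI ballI allI impI)
  fix x y u v :: real
  assume "x \<in> {- c..- a}" "y \<in> {- c..- a}" and uv: "0 \<le> u" "0 \<le> v" "u + v = 1"
  then have "- x \<in> {a..c}" "- y \<in> {a..c}" by auto
  with uv have "u * g (- x) + v * g (- y) \<le> g (u *\<^sub>R (- x) + v *\<^sub>R (- y))"
    using assms unfolding concave_on_iff by blast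
  then show "u * g (- x) + v * g (- y) \<le> g (- (u *\<^sub>R x + v *\<^sub>R y))"
    by simp
qed simp

text \<open>
  The mirror image of \<open>Taylor_integral_bound\<close>, for an expansion about the right end point. The
  reflected functions \<open>x \<mapsto> (-1) ^ k * D k (- x)\<close> again form a chain of successive derivatives,
  and their signs are the ones that appear in the sum.
\<close>

lemma Taylor_integral_bound_left:
  fixes D :: "nat \<Rightarrow> real \<Rightarrow> real"
  assumes n: "n \<ge> 1" and ac: "a \<le> c" and conj: "conjugate_exponents p q"
    and D: "\<And>k t. k < n \<Longrightarrow> t \<in> {a..c} \<Longrightarrow>
        (D k has_real_derivative D (Suc k) t) (at t within {a..c})"
    and conc: "concave_on {a..c} (\<lambda>x. \<bar>D n x\<bar> powr q)"
  shows "\<bar>integral {a..c} (D 0)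
             - (\<Sum>m=1..n. (c - a) ^ m / fact m * ((-1) ^ (m - 1) * D (m - 1) c))\<bar>
           \<le> conjugate_factor n p / fact n * ((c - a) ^ (n + 1) * \<bar>D n ((a + c) / 2)\<bar>)"
proof -
  define E where "E k x = (-1) ^ k * D k (- x)" for k x
  have E: "(E k has_real_derivative E (Suc k) t) (at t within {- c..- a})"
    if "k < n" "t \<in> {- c..- a}" for k t
  proof -
    have "(D k has_real_derivative D (Suc k) (- t)) (at (- t) within {a..c})"
      using that by (intro D) auto
    then have "((\<lambda>x. D k (- x)) has_real_derivative D (Suc k) (- t) * (- 1))
        (at t within {- c..- a})"
      by (intro DERIV_image_chain[where f = "D k" and g = uminus, unfolded o_def])
        (auto intro!: derivative_eq_intros)
    from DERIV_cmult[OF this, of "(-1) ^ k"] show ?thesis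
      by (simp add: E_def[abs_def])
  qed
  have concE: "concave_on {- c..- a} (\<lambda>x. \<bar>E n x\<bar> powr q)"
    using concave_on_Icc_reflect[OF conc] by (simp add: E_def abs_mult power_abs)
  have mid: "- ((a + c) / 2) = (- c + - a) / 2" by (simp add: field_simps)
  have "\<bar>integral {- c..- a} (E 0)
        - (\<Sum>m=1..n. (- a - - c) ^ m / fact m * E (m - 1) (- c))\<bar>
      \<le> conjugate_factor n p / fact n * ((- a - - c) ^ (n + 1) * \<bar>E n (- ((a + c) / 2))\<bar>)"
    unfolding mid using ac by (intro Taylor_integral_bound[where q = q] n conj E concE) auto
  moreover have "integral {- c..- a} (E 0) = integral {a..c} (D 0)"
    by (simp add: E_def[abs_def])
  ultimately show ?thesis
    by (simp add: E_def abs_mult power_abs)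
qed

section \<open>The inequality for an arbitrary intermediate point\<close>

theorem theorem4:
  fixes n :: nat and I :: "real set" and f :: "real \<Rightarrow> real"
    and a b c q :: real and p :: ennreal
  assumes "n \<ge> 1"
    and "is_interval I" and "I \<subseteq> {0..}"
    and "a \<in> I" and "b \<in> I" and "a < b"
    and "times_differentiable_on I n f (interior I \<union> {a..b})"
    and "nth_deriv_within I n f absolutely_integrable_on {a..b}"
    and "conjugate_exponents p q"
    and "concave_on {a..b} (\<lambda>x. \<bar>nth_deriv_within I n f x\<bar> powr q)"
    and "c \<in> {a..b}"
  shows "\<bar>(-1) ^ n * integral {a..b} f
           + (\<Sum>m=1..n. (-1) ^ (n - m + 2) * (((c - a) ^ m - (c - b) ^ m) / fact m)
                         * nth_deriv_within I (m - 1) f c)\<bar>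
         \<le> conjugate_factor n p / fact n
             * ((c - a) ^ (n + 1) * \<bar>nth_deriv_within I n f ((a + c) / 2)\<bar>
                + (b - c) ^ (n + 1) * \<bar>nth_deriv_within I n f ((b + c) / 2)\<bar>)"
proof -
  define D where "D k = nth_deriv_within I k f" for k
  have sub: "{a..b} \<subseteq> I"
    using mem_is_interval_1_I[OF assms(2,4,5)] by auto
  have D: "(D k has_real_derivative D (Suc k) t) (at t within T)"
    if "k < n" "t \<in> {a..b}" "T \<subseteq> I" for k t T
  proof -
    have "D k differentiable (at t within I)"
      using assms(7) that by (auto simp: times_differentiable_on_def D_def)
    then have "(D k has_real_derivative D (Suc k) t) (at t within I)"
      by (simp add: D_def vector_derivative_works has_real_derivative_iff_has_vector_derivative)
    then show ?thesis using that(3) by (rule DERIV_subset)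
  qed
  have conc: "concave_on T (\<lambda>x. \<bar>D n x\<bar> powr q)" if "T \<subseteq> {a..b}" "convex T" for T
    using assms(10) that by (auto simp: concave_on_iff D_def subset_eq)
  define R where "R = integral {c..b} (D 0) - (\<Sum>m=1..n. (b - c) ^ m / fact m * D (m - 1) c)"
  have R: "\<bar>R\<bar> \<le> conjugate_factor n p / fact n
      * ((b - c) ^ (n + 1) * \<bar>D n ((c + b) / 2)\<bar>)"
    unfolding R_def using assms sub
    by (intro Taylor_integral_bound[where q = q] D conc) auto

  define L where "L = integral {a..c} (D 0)
      - (\<Sum>m=1..n. (c - a) ^ m / fact m * ((-1) ^ (m - 1) * D (m - 1) c))"
  have L: "\<bar>L\<bar> \<le> conjugate_factor n p / fact n
      * ((c - a) ^ (n + 1) * \<bar>D n ((a + c) / 2)\<bar>)"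
    unfolding L_def using assms sub
    by (intro Taylor_integral_bound_left[where q = q] D conc) auto

  have "continuous_on {a..b} f"
    using D[of 0 _ "{a..b}"] assms(1) sub by (intro DERIV_continuous_on) (auto simp: D_def)
  then have "integral {a..b} f = integral {a..c} f + integral {c..b} f"
    using assms(11) by (simp add: Henstock_Kurzweil_Integration.integral_combine integrable_continuous_real)
  then have I: "integral {a..b} f = integral {a..c} (D 0) + integral {c..b} (D 0)"
    by (simp add: D_def)
  \<comment> \<open>The signs: \<open>(c - b) ^ m = (-1) ^ m * (b - c) ^ m\<close> and \<open>(-1) ^ (n - m) = (-1) ^ n * (-1) ^ m\<close>
    turn each summand into a term of the expansion towards \<open>a\<close> plus one of that towards \<open>b\<close>.\<close>
  have term_eq: "(-1) ^ (n - m + 2) * (((c - a) ^ m - (c - b) ^ m) / fact m) * D (m - 1) c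
      = - ((-1) ^ n * ((c - a) ^ m / fact m * ((-1) ^ (m - 1) * D (m - 1) c)
          + (b - c) ^ m / fact m * D (m - 1) c))"
    if m: "m \<in> {1..n}" for m
  proof -
    obtain j where j: "m = Suc j" using m by (cases m) auto
    define e where "e = (-1 :: real) ^ (m - 1)"
    define s where "s = (-1 :: real) ^ (n - m)"
    have ee: "e * e = 1" by (simp add: e_def flip: power_mult_distrib)
    have em: "(-1) ^ m = - e" using j by (simp add: e_def)
    have "(c - b) ^ m = (-1) ^ m * (b - c) ^ m"
      by (metis minus_diff_eq mult_minus1 power_mult_distrib)
    then have cb: "(c - b) ^ m = - (e * (b - c) ^ m)" by (simp add: em)
    have "(-1) ^ n = s * (-1) ^ m"
      using m by (simp add: s_def flip: power_add)
    then have sn: "(-1) ^ n = - (s * e)" by (simp add: em)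
    have sm: "(-1) ^ (n - m + 2) = s" by (simp add: s_def)
    have "s * e * ((c - a) ^ m / fact m * (e * D (m - 1) c) + (b - c) ^ m / fact m * D (m - 1) c)
        = s * ((e * e) * (c - a) ^ m / fact m + e * (b - c) ^ m / fact m) * D (m - 1) c"
      by (simp add: algebra_simps)
    also have "\<dots> = s * (((c - a) ^ m - - (e * (b - c) ^ m)) / fact m) * D (m - 1) c"
      by (simp add: ee add_divide_distrib)
    finally show ?thesis
      unfolding cb sn sm e_def[symmetric] by simp
  qed
  have "(-1) ^ n * integral {a..b} f
           + (\<Sum>m=1..n. (-1) ^ (n - m + 2) * (((c - a) ^ m - (c - b) ^ m) / fact m)
                         * nth_deriv_within I (m - 1) f c) = (-1) ^ n * (L + R)"
  proof -
    have "(\<Sum>m=1..n. (-1) ^ (n - m + 2) * (((c - a) ^ m - (c - b) ^ m) / fact m)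
                         * nth_deriv_within I (m - 1) f c)
        = (\<Sum>m=1..n. - ((-1) ^ n * ((c - a) ^ m / fact m * ((-1) ^ (m - 1) * D (m - 1) c)
              + (b - c) ^ m / fact m * D (m - 1) c)))"
      by (rule sum.cong[OF refl]) (use term_eq in \<open>simp add: D_def\<close>)
    also have "\<dots> = - ((-1) ^ n * ((\<Sum>m=1..n. (c - a) ^ m / fact m * ((-1) ^ (m - 1) * D (m - 1) c))
              + (\<Sum>m=1..n. (b - c) ^ m / fact m * D (m - 1) c)))"
      by (simp only: sum_negf sum.distrib flip: sum_distrib_left)
    finally show ?thesis
      by (simp add: I L_def R_def algebra_simps)
  qed
  then have "\<bar>(-1) ^ n * integral {a..b} f
           + (\<Sum>m=1..n. (-1) ^ (n - m + 2) * (((c - a) ^ m - (c - b) ^ m) / fact m)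
                         * nth_deriv_within I (m - 1) f c)\<bar> = \<bar>L + R\<bar>"
    by (simp add: abs_mult power_abs)
  also have "\<dots> \<le> \<bar>L\<bar> + \<bar>R\<bar>" by simp
  also have "\<dots> \<le> conjugate_factor n p / fact n
      * ((c - a) ^ (n + 1) * \<bar>D n ((a + c) / 2)\<bar>)
      + conjugate_factor n p / fact n * ((b - c) ^ (n + 1) * \<bar>D n ((c + b) / 2)\<bar>)"
    using L R by linarith
  finally show ?thesis
    by (simp add: D_def distrib_left add.commute[of b c])
qed

end
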